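(* Let $s:\{1,\dots,37\}\to\{1,\dots,7\}$ be a map such that the cells of each of the 21 rows receive pairwise distinct values and each of the six non-central circles $\{1,2,5,6,7,11,12\}$, $\{3,4,7,8,9,13,14\}$, $\{10,11,16,17,18,23,24\}$, $\{14,15,20,21,22,27,28\}$, $\{24,25,29,30,31,34,35\}$, $\{26,27,31,32,33,36,37\}$ receives seven pairwise distinct values. Then the cells of the central circle $\{12,13,18,19,20,25,26\}$ also receive pairwise distinct values.
   Context: The Septoku board consists of 37 cells forming a regular hexagon of side 4 in a hexagonal grid, numbered row by row: $1$–$4$ (top row), $5$–$9$, $10$–$15$, $16$–$22$, $23$–$28$, $29$–$33$, $34$–$37$ (bottom row). The 21 "rows" of the board (lines of cells in the three grid directions) are: horizontal $\{1,2,3,4\}$, $\{5,\dots,9\}$, $\{10,\dots,15\}$, $\{16,\dots,22\}$, $\{23,\dots,28\}$, $\{29,\dots,33\}$, $\{34,\dots,37\}$; up-right $\{1,5,10,16\}$, $\{2,6,11,17,23\}$, $\{3,7,12,18,24,29\}$, $\{4,8,13,19,25,30,34\}$, $\{9,14,20,26,31,35\}$, $\{15,21,27,32,36\}$, $\{22,28,33,37\}$; down-right $\{4,9,15,22\}$, $\{3,8,14,21,28\}$, $\{2,7,13,20,27,33\}$, $\{1,6,12,19,26,32,37\}$, $\{5,11,18,25,31,36\}$, $\{10,17,24,30,35\}$, $\{16,23,29,34\}$. *)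

theory Defs
  imports Main "HOL-Library.FuncSet"
begin

text \<open>
  The cells of the hexagonal board of side 4 are numbered from left to right and from top to
  bottom:

  \<^verbatim>\<open>
              1   2   3   4
            5   6   7   8   9
         10  11  12  13  14  15
       16  17  18  19  20  21  22
         23  24  25  26  27  28
           29  30  31  32  33
             34  35  36  37
  \<close>
\<close>

definition cells :: "nat set" where
  "cells = {1..37}"

definition horizontal_rows :: "nat set set" where
  "horizontal_rows =
    {{1, 2, 3, 4},
     {5, 6, 7, 8, 9},
     {10, 11, 12, 13, 14, 15},
     {16, 17, 18, 19, 20, 21, 22},
     {23, 24, 25, 26, 27, 28},
     {29, 30, 31, 32, 33},
     {34, 35, 36, 37}}"

definition up_right_rows :: "nat set set" where
  "up_right_rows =
    {{1, 5, 10, 16},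
     {2, 6, 11, 17, 23},
     {3, 7, 12, 18, 24, 29},
     {4, 8, 13, 19, 25, 30, 34},
     {9, 14, 20, 26, 31, 35},
     {15, 21, 27, 32, 36},
     {22, 28, 33, 37}}"

definition down_right_rows :: "nat set set" where
  "down_right_rows =
    {{4, 9, 15, 22},
     {3, 8, 14, 21, 28},
     {2, 7, 13, 20, 27, 33},
     {1, 6, 12, 19, 26, 32, 37},
     {5, 11, 18, 25, 31, 36},
     {10, 17, 24, 30, 35},
     {16, 23, 29, 34}}"

definition rows :: "nat set set" where
  "rows = horizontal_rows \<union> up_right_rows \<union> down_right_rows"

definition outer_circles :: "nat set set" where
  "outer_circles =
    {{1, 2, 5, 6, 7, 11, 12},
     {3, 4, 7, 8, 9, 13, 14},
     {10, 11, 16, 17, 18, 23, 24},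
     {14, 15, 20, 21, 22, 27, 28},
     {24, 25, 29, 30, 31, 34, 35},
     {26, 27, 31, 32, 33, 36, 37}}"

definition central_circle :: "nat set" where
  "central_circle = {12, 13, 18, 19, 20, 25, 26}"

end

theory Submission
  imports Defs
begin

text \<open>
  Each outer circle holds all seven values. Two cells of the central circle that share no row are
  at distance \<open>\<surd>3\<close>; say they are 12 and 20, with common value \<open>v\<close>. The rows and circles through
  them leave 23 as the only place for \<open>v\<close> in the left circle, hence 30 as the only one in the
  bottom left circle, while the top right circle has \<open>v\<close> in 4 or 8; but 4, 8 and 30 share a row.
  The other five pairs arise by rotation.
\<close>

text \<open>Pigeonhole: \<open>s\<close> injects the seven cells of \<open>c\<close> into the seven
  values, hence onto them.\<close>

lemma value_attained:
  fixes s :: "nat \<Rightarrow> nat"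
  assumes "s \<in> cells \<rightarrow> {1..7}" and "\<forall>c \<in> outer_circles. inj_on s c"
    and "c \<in> outer_circles" and "i \<in> cells"
  shows "\<exists>j\<in>c. s j = s i"
proof -
  have c: "c \<subseteq> cells" "card c = 7"
    using assms(3) by (auto simp: outer_circles_def cells_def)
  then have "s ` c \<subseteq> {1..7}" "card (s ` c) = 7"
    using assms by (auto simp: card_image)
  then have "s ` c = {1..7}"
    by (intro card_subset_eq) auto
  then show ?thesis
    using assms(1,4) by (metis PiE imageE)
qed

theorem theorem8:
  fixes s :: "nat \<Rightarrow> nat"
  assumes "s \<in> cells \<rightarrow> {1..7}"
    and "\<forall>r \<in> rows. inj_on s r"
    and "\<forall>c \<in> outer_circles. inj_on s c"
  shows "inj_on s central_circle"
proof -
  have attained: "\<forall>c\<in>outer_circles. \<exists>j\<in>c. s j = s i" if "i \<in> {12, 13, 18, 20, 25, 26}" for i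
    using value_attained[OF assms(1,3)] that by (force simp: cells_def)
  \<comment> \<open>This yields inequations between cells; the next \<open>note\<close> yields one
    seven-way disjunction per outer circle, so a finite case analysis suffices below.\<close>
  note distinct = assms(2,3)[unfolded rows_def horizontal_rows_def up_right_rows_def
      down_right_rows_def outer_circles_def, simplified]
  note attained = attained[unfolded outer_circles_def, simplified]
  have "s 12 \<noteq> s 20" using distinct attained[of 12] by (smt (verit))
  moreover have "s 12 \<noteq> s 25" using distinct attained[of 12] by (smt (verit))
  moreover have "s 13 \<noteq> s 18" using distinct attained[of 13] by (smt (verit))
  moreover have "s 13 \<noteq> s 26" using distinct attained[of 13] by (smt (verit))
  moreover have "s 18 \<noteq> s 26" using distinct attained[of 18] by (smt (verit))
  moreover have "s 20 \<noteq> s 25" using distinct attained[of 20] by (smt (verit))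
  \<comment> \<open>Every other pair in the central circle (adjacent, opposite or containing 19)
    shares a row.\<close>
  ultimately show ?thesis
    using distinct by (simp add: central_circle_def)
qed

end
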